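(* Let $M$ be a transversal matroid of rank $r$ on $E$ and $\mathcal{A}$ a presentation of $M$. The sets in $L_\mathcal{A}$ are exactly: (1) the sets $s_\mathcal{A}(X)$ where $X$ is an independent set of $M$ with $|X|=|s_\mathcal{A}(X)|$, and (2) all intersections of such sets. In particular, for $I\in L_\mathcal{A}$, if $\mathcal{C}_x$ is the set of all circuits of $M[\mathcal{A}^I]$ that contain $x$, then $$I=\bigcap_{C\in\mathcal{C}_x}s_\mathcal{A}(C-\{x\}).$$ Moreover, item (1) may be replaced by: (1$'$) the sets $s_\mathcal{A}(Y)$ with $Y\subseteq E$ and $r(Y)=|s_\mathcal{A}(Y)|$.
   Context: $[r]=\{1,\dots,r\}$. For a set system $\mathcal{A}=(A_i:i\in[r])$ on a finite set $E$, $M[\mathcal{A}]$ is the transversal matroid on $E$ whose independent sets are the partial transversals of $\mathcal{A}$ (sets $X\subseteq E$ admitting an injection $\phi:X\to[r]$ with $e\in A_{\phi(e)}$); $\mathcal{A}$ is a presentation of $M[\mathcal{A}]$, and presentations of a rank-$r$ matroid are taken to have exactly $r$ sets. For $X\subseteq E$, the support is $s_\mathcal{A}(X)=\{i\in[r]: X\cap A_i\neq\emptyset\}$. Fix $x\notin E$; for $I\subseteq[r]$, $\mathcal{A}^I$ is obtained from $\mathcal{A}$ by replacing $A_i$ by $A_i\cup\{x\}$ for each $i\in I$. Let $\sigma_\mathcal{A}(I)=I\cup\{k\in[r]-I: x\text{ is a coloop of } M[\mathcal{A}^I]\backslash A_k\}$; $L_\mathcal{A}$ is the set of $I\subseteq[r]$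 with $\sigma_\mathcal{A}(I)=I$. $r(\cdot)$ is the rank function of $M$. An empty intersection is interpreted as $[r]$. *)

theory Defs
  imports Main "HOL-Library.FuncSet"
begin

datatype 'a indep_system = Indep_System (ground: "'a set") (indeps: "'a set set")

definition matroid :: "'a indep_system \<Rightarrow> bool" where
  "matroid M \<longleftrightarrow>
     finite (ground M) \<and>
     indeps M \<subseteq> Pow (ground M) \<and>
     {} \<in> indeps M \<and>
     (\<forall>X Y. X \<in> indeps M \<longrightarrow> Y \<subseteq> X \<longrightarrow> Y \<in> indeps M) \<and>
     (\<forall>X Y. X \<in> indeps M \<longrightarrow> Y \<in> indeps M \<longrightarrow> card X < card Y \<longrightarrow>
        (\<exists>y\<in>Y - X. insert y X \<in> indeps M))"

definition rank_of :: "'a indep_system \<Rightarrow> 'a set \<Rightarrow> nat" where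
  "rank_of M X = Max (card ` {Y \<in> indeps M. Y \<subseteq> X})"

definition bases :: "'a indep_system \<Rightarrow> 'a set set" where
  "bases M = {B \<in> indeps M. \<forall>Y\<in>indeps M. B \<subseteq> Y \<longrightarrow> Y = B}"

definition circuits :: "'a indep_system \<Rightarrow> 'a set set" where
  "circuits M = {C. C \<subseteq> ground M \<and> C \<notin> indeps M \<and> (\<forall>D. D \<subset> C \<longrightarrow> D \<in> indeps M)}"

definition coloop :: "'a indep_system \<Rightarrow> 'a \<Rightarrow> bool" where
  "coloop M e \<longleftrightarrow> e \<in> ground M \<and> (\<forall>B\<in>bases M. e \<in> B)"

definition deletion :: "'a indep_system \<Rightarrow> 'a set \<Rightarrow> 'a indep_system" where
  "deletion M D = Indep_System (ground M - D) {X \<in> indeps M. X \<subseteq> ground M - D}"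

text \<open>A set system \<open>(A\<^sub>1, \<dots>, A\<^sub>r)\<close> is given by its length \<open>r\<close> and a function
  \<open>A\<close> of which only the values on \<open>{1..r}\<close> are used.\<close>

definition partial_transversal :: "nat \<Rightarrow> (nat \<Rightarrow> 'a set) \<Rightarrow> 'a set \<Rightarrow> bool" where
  "partial_transversal r A X \<longleftrightarrow>
     (\<exists>\<phi>. \<phi> \<in> X \<rightarrow> {1..r} \<and> inj_on \<phi> X \<and> (\<forall>e\<in>X. e \<in> A (\<phi> e)))"

definition transversal_matroid :: "'a set \<Rightarrow> nat \<Rightarrow> (nat \<Rightarrow> 'a set) \<Rightarrow> 'a indep_system" where
  "transversal_matroid E r A = Indep_System E {X. X \<subseteq> E \<and> partial_transversal r A X}"

text \<open>Presentations have as many sets as the rank of the matroid.\<close>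

definition presentation :: "nat \<Rightarrow> (nat \<Rightarrow> 'a set) \<Rightarrow> 'a indep_system \<Rightarrow> bool" where
  "presentation r A M \<longleftrightarrow>
     (\<forall>i\<in>{1..r}. A i \<subseteq> ground M) \<and>
     M = transversal_matroid (ground M) r A \<and>
     rank_of M (ground M) = r"

definition support :: "nat \<Rightarrow> (nat \<Rightarrow> 'a set) \<Rightarrow> 'a set \<Rightarrow> nat set" where
  "support r A X = {i \<in> {1..r}. X \<inter> A i \<noteq> {}}"

definition extend_system :: "(nat \<Rightarrow> 'a set) \<Rightarrow> 'a \<Rightarrow> nat set \<Rightarrow> nat \<Rightarrow> 'a set" where
  "extend_system A x I = (\<lambda>i. if i \<in> I then insert x (A i) else A i)"

definition ext_matroid ::
  "'a set \<Rightarrow> nat \<Rightarrow> (nat \<Rightarrow> 'a set) \<Rightarrow> 'a \<Rightarrow> nat set \<Rightarrow> 'a indep_system" where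
  "ext_matroid E r A x I = transversal_matroid (insert x E) r (extend_system A x I)"

definition sigma_cl ::
  "'a set \<Rightarrow> nat \<Rightarrow> (nat \<Rightarrow> 'a set) \<Rightarrow> 'a \<Rightarrow> nat set \<Rightarrow> nat set" where
  "sigma_cl E r A x I =
     I \<union> {k \<in> {1..r} - I. coloop (deletion (ext_matroid E r A x I) (A k)) x}"

definition closed_index_sets ::
  "'a set \<Rightarrow> nat \<Rightarrow> (nat \<Rightarrow> 'a set) \<Rightarrow> 'a \<Rightarrow> nat set set" where
  "closed_index_sets E r A x = {I. I \<subseteq> {1..r} \<and> sigma_cl E r A x I = I}"

text \<open>Intersection of subsets of \<open>{1..r}\<close>; the empty intersection is \<open>{1..r}\<close>.\<close>

definition index_Inter :: "nat \<Rightarrow> nat set set \<Rightarrow> nat set" where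
  "index_Inter r F = {1..r} \<inter> \<Inter>F"

definition all_Inters :: "nat \<Rightarrow> nat set set \<Rightarrow> nat set set" where
  "all_Inters r F = {index_Inter r G | G. G \<subseteq> F}"

lemma transversal_augment:
  fixes f g :: "'a \<Rightarrow> nat"
  assumes "finite X" "finite Y" "card X < card Y"
    and "f \<in> X \<rightarrow> {1..r}" "inj_on f X" "\<forall>e\<in>X. e \<in> A (f e)"
    and "g \<in> Y \<rightarrow> {1..r}" "inj_on g Y" "\<forall>e\<in>Y. e \<in> A (g e)"
  shows "\<exists>y\<in>Y - X. partial_transversal r A (insert y X)"
  using assms
proof (induction "card {e \<in> X \<inter> Y. f e \<noteq> g e}" arbitrary: f rule: less_induct)
  case less
  have "card (f ` X) < card (g ` Y)"
    using less.prems(3) by (simp only: card_image[OF less.prems(5)] card_image[OF less.prems(8)])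
  then have "\<not> g ` Y \<subseteq> f ` X"
    using less.prems(1) card_mono[OF finite_imageI[OF less.prems(1)], of "g ` Y" f] by linarith
  then obtain y where y: "y \<in> Y" "g y \<notin> f ` X" by blast
  let ?f = "f(y := g y)"
  have f'1: "inj_on ?f (insert y X)"
  proof (rule inj_onI)
    fix a b assume "a \<in> insert y X" "b \<in> insert y X" and eq: "?f a = ?f b"
    then consider "a = y" "b = y" | "a = y" "b \<noteq> y" "b \<in> X" | "a \<noteq> y" "b = y" "a \<in> X"
      | "a \<noteq> y" "b \<noteq> y" "a \<in> X" "b \<in> X" by blast
    then show "a = b"
    proof cases
      case 1 then show ?thesis by simp
    next
      case 2 then have "g y = f b" using eq by simp
      then show ?thesis using y(2) 2(3) by blast
    next
      case 3 then have "g y = f a" using eq by simp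
      then show ?thesis using y(2) 3(3) by blast
    next
      case 4 then have "f a = f b" using eq by simp
      then show ?thesis using less.prems(5) 4(3,4) by (simp add: inj_on_eq_iff)
    qed
  qed
  have f'2: "?f \<in> insert y X \<rightarrow> {1..r}"
    using less.prems(4,7) y(1) by (auto simp: Pi_iff)
  have f'3: "\<forall>e\<in>insert y X. e \<in> A (?f e)"
    using less.prems(6,9) y(1) by simp
  note f' = f'1 f'2 f'3
  show ?case
  proof (cases "y \<in> X")
    case False
    then show ?thesis using y f' unfolding partial_transversal_def by blast
  next
    case True
    have "f y \<noteq> g y" using y(2) imageI[OF True, of f] by metis
    then have "{e \<in> X \<inter> Y. ?f e \<noteq> g e} \<subset> {e \<in> X \<inter> Y. f e \<noteq> g e}"
      using y True by auto
    then have smaller: "card {e \<in> X \<inter> Y. ?f e \<noteq> g e} < card {e \<in> X \<inter> Y. f e \<noteq> g e}"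
      using less.prems(1) by (intro psubset_card_mono) auto
    have ins: "insert y X = X" using True by auto
    show ?thesis
      by (rule less.hyps[OF smaller less.prems(1-3) f'2[unfolded ins] f'1[unfolded ins]
            f'3[unfolded ins] less.prems(7-9)])
  qed
qed

lemma matroid_transversal_matroid:
  assumes "finite E"
  shows "matroid (transversal_matroid E r A)"
  unfolding matroid_def transversal_matroid_def indep_system.sel
proof (intro conjI allI impI)
  show "finite E" by fact
  show "{X. X \<subseteq> E \<and> partial_transversal r A X} \<subseteq> Pow E" by auto
  show "{} \<in> {X. X \<subseteq> E \<and> partial_transversal r A X}"
    by (auto simp: partial_transversal_def)
next
  fix X Y assume X: "X \<in> {X. X \<subseteq> E \<and> partial_transversal r A X}" and sub: "Y \<subseteq> X"
  obtain f where f: "f \<in> X \<rightarrow> {1..r}" "inj_on f X" "\<forall>e\<in>X. e \<in> A (f e)"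
    using X unfolding partial_transversal_def by blast
  have "f \<in> Y \<rightarrow> {1..r}" "inj_on f Y" "\<forall>e\<in>Y. e \<in> A (f e)"
    using f(1,3) sub inj_on_subset[OF f(2) sub] by blast+
  then show "Y \<in> {X. X \<subseteq> E \<and> partial_transversal r A X}"
    using X sub unfolding partial_transversal_def by blast
next
  fix X Y
  assume X: "X \<in> {X. X \<subseteq> E \<and> partial_transversal r A X}"
    and Y: "Y \<in> {X. X \<subseteq> E \<and> partial_transversal r A X}" and c: "card X < card Y"
  obtain f where f: "f \<in> X \<rightarrow> {1..r}" "inj_on f X" "\<forall>e\<in>X. e \<in> A (f e)"
    using X unfolding partial_transversal_def by blast
  obtain g where g: "g \<in> Y \<rightarrow> {1..r}" "inj_on g Y" "\<forall>e\<in>Y. e \<in> A (g e)"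
    using Y unfolding partial_transversal_def by blast
  have "finite X" "finite Y" using X Y assms by (simp_all add: rev_finite_subset)
  then obtain y where "y \<in> Y - X" "partial_transversal r A (insert y X)"
    using transversal_augment[OF _ _ c f g] by blast
  then show "\<exists>y\<in>Y - X. insert y X \<in> {X. X \<subseteq> E \<and> partial_transversal r A X}"
    using X Y by auto
qed

end

theory Submission
  imports Defs
begin

text \<open>
  Call an independent set \<open>X\<close> of \<open>M\<close> tight if \<open>|X| = |s(X)|\<close>. By Hall's theorem, for \<open>Z\<close>
  independent in \<open>M\<close>, the set \<open>Z \<union> {x}\<close> is dependent in \<open>M[A\<^sup>I]\<close> iff \<open>Z\<close> has a tight subset \<open>X\<close>
  with \<open>I \<subseteq> s(X)\<close>: a violation of Hall's condition must involve \<open>x\<close>, so it reads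
  \<open>|s(X) \<union> I| \<le> |X| \<le> |s(X)|\<close>. Moreover \<open>x\<close> fails to be a coloop of \<open>M[A\<^sup>I] - A\<^sub>k\<close> iff some
  independent set disjoint from \<open>A\<^sub>k\<close> becomes dependent when \<open>x\<close> is added. Hence \<open>I\<close> is closed
  iff every \<open>k\<close> outside \<open>I\<close> is avoided by the support of a tight set whose support contains \<open>I\<close>,
  that is, iff \<open>I\<close> is an intersection of supports of tight sets.
\<close>

section \<open>Hall's marriage theorem\<close>

text \<open>Induction on \<open>|X|\<close> with two cases. If a nonempty proper subset
  \<open>W\<close> has exactly \<open>|W|\<close> neighbours, match \<open>W\<close> first and the
  rest outside those neighbours. Otherwise every nonempty proper subset has a neighbour to spare, so
  one arbitrary pair can be matched and removed.\<close>

theorem hall_marriage: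
  fixes N :: "'a \<Rightarrow> 'b set"
  assumes "finite X" "\<And>e. e \<in> X \<Longrightarrow> finite (N e)"
    and "\<And>W. W \<subseteq> X \<Longrightarrow> card W \<le> card (\<Union>(N ` W))"
  shows "\<exists>\<phi>. inj_on \<phi> X \<and> (\<forall>e\<in>X. \<phi> e \<in> N e)"
  using assms
proof (induction "card X" arbitrary: X N rule: less_induct)
  case less
  note fin = less.prems(1) and finN = less.prems(2) and hall = less.prems(3)
  show ?case
  proof (cases "\<exists>W. W \<subset> X \<and> W \<noteq> {} \<and> card (\<Union>(N ` W)) = card W")
    case True
    then obtain W where W: "W \<subset> X" "W \<noteq> {}" "card (\<Union>(N ` W)) = card W" by blast
    have finW: "finite W" using W(1) fin finite_subset by blast
    have "card W < card X" using W(1) fin psubset_card_mono by blast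
    then obtain f where f: "inj_on f W" "\<forall>e\<in>W. f e \<in> N e"
      using less.hyps[of W N] W(1) finW finN hall by (meson psubsetE subsetD subset_trans)
    define U where "U = \<Union>(N ` W)"
    have finU: "finite U" unfolding U_def using finW finN W(1) by blast
    have "card (X - W) < card X"
      using W(1,2) fin by (intro psubset_card_mono) auto
    \<comment> \<open>Hall's condition survives the removal of \<open>U\<close>: apply it to
      \<open>V \<union> W\<close>, whose neighbours are \<open>U\<close> together with those of
      \<open>V\<close> outside \<open>U\<close>, and cancel \<open>|U| = |W|\<close>.\<close>
    moreover have "card V \<le> card (\<Union>((\<lambda>e. N e - U) ` V))" if V: "V \<subseteq> X - W" for V
    proof -
      have finV: "finite V" using V fin finite_subset by blast
      have finNV: "finite (\<Union>(N ` V))" using finV finN V by blast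
      have "card V + card W = card (V \<union> W)"
        using V finV finW by (subst card_Un_disjoint) auto
      also have "\<dots> \<le> card (\<Union>(N ` (V \<union> W)))" using V W(1) by (intro hall) auto
      also have "\<Union>(N ` (V \<union> W)) = (\<Union>(N ` V) - U) \<union> U" unfolding U_def by blast
      also have "card \<dots> = card (\<Union>(N ` V) - U) + card U"
        using finNV finU by (intro card_Un_disjoint) auto
      finally have "card V \<le> card (\<Union>(N ` V) - U)" using W(3) by (simp add: U_def)
      also have "\<Union>(N ` V) - U = \<Union>((\<lambda>e. N e - U) ` V)" by blast
      finally show ?thesis .
    qed
    ultimately obtain g where g: "inj_on g (X - W)" "\<forall>e\<in>X - W. g e \<in> N e - U"
      using less.hyps[of "X - W" "\<lambda>e. N e - U"] fin finN by auto
    define h where "h e = (if e \<in> W then f e else g e)" for e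
    have fU: "f e \<in> U" if "e \<in> W" for e using f(2) that unfolding U_def by blast
    have "inj_on h X"
    proof (rule inj_onI)
      fix a b assume ab: "a \<in> X" "b \<in> X" "h a = h b"
      \<comment> \<open>The values of \<open>f\<close> lie in \<open>U\<close> and those of
        \<open>g\<close> avoid it, so no collision occurs between the two pieces.\<close>
      have "a \<in> W \<longleftrightarrow> b \<in> W"
        using ab g(2) fU unfolding h_def by (metis Diff_iff)
      then show "a = b"
        using ab f(1) g(1) unfolding h_def by (auto simp: inj_on_eq_iff split: if_splits)
    qed
    moreover have "\<forall>e\<in>X. h e \<in> N e" using f(2) g(2) unfolding h_def by auto
    ultimately show ?thesis by blast
  next
    case strict: False
    show ?thesis
    proof (cases "X = {}")
      case True then show ?thesis by simp
    next
      case False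
      then obtain a where a: "a \<in> X" by blast
      have "card {a} \<le> card (N a)" using hall[of "{a}"] a by simp
      then obtain b where b: "b \<in> N a" by fastforce
      have "card (X - {a}) < card X" using a fin by (rule card_Diff1_less[rotated])
      moreover have "card V \<le> card (\<Union>((\<lambda>e. N e - {b}) ` V))" if V: "V \<subseteq> X - {a}" for V
      proof (cases "V = {}")
        case False
        have finNV: "finite (\<Union>(N ` V))" using finite_subset[OF _ fin, of V] finN V by blast
        have "card V \<le> card (\<Union>(N ` V))" using V by (intro hall) auto
        \<comment> \<open>\<open>V\<close> misses \<open>a\<close>, so it is a nonempty proper
          subset and has at least \<open>|V| + 1\<close> neighbours; the surplus pays for the loss
          of \<open>b\<close>.\<close>
        moreover have "card (\<Union>(N ` V)) \<noteq> card V" using strict V False a by blast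
        ultimately have "card V \<le> card (\<Union>(N ` V)) - 1" by linarith
        also have "\<dots> \<le> card (\<Union>(N ` V) - {b})" using finNV by (simp add: card_Diff_singleton_if)
        also have "\<Union>(N ` V) - {b} = \<Union>((\<lambda>e. N e - {b}) ` V)" by blast
        finally show ?thesis .
      qed simp
      ultimately obtain g where g: "inj_on g (X - {a})" "\<forall>e\<in>X - {a}. g e \<in> N e - {b}"
        using less.hyps[of "X - {a}" "\<lambda>e. N e - {b}"] fin finN by auto
      have "inj_on (g(a := b)) X"
        using g by (auto simp: inj_on_def)
      moreover have "\<forall>e\<in>X. (g(a := b)) e \<in> N e" using g(2) b by auto
      ultimately show ?thesis by blast
    qed
  qed
qed

section \<open>Supports and Hall's condition for partial transversals\<close>

lemma finite_support: "finite (support r A X)"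
  by (simp add: support_def)

lemma support_mono: "X \<subseteq> Y \<Longrightarrow> support r A X \<subseteq> support r A Y"
  by (auto simp: support_def)

lemma partial_transversal_card_le:
  assumes "partial_transversal r A X" "W \<subseteq> X"
  shows "card W \<le> card (support r A W)"
proof -
  obtain f where f: "f \<in> X \<rightarrow> {1..r}" "inj_on f X" "\<forall>e\<in>X. e \<in> A (f e)"
    using assms(1) unfolding partial_transversal_def by blast
  have "card W = card (f ` W)"
    using inj_on_subset[OF f(2) assms(2)] by (simp add: card_image)
  also have "f ` W \<subseteq> support r A W"
    using f(1,3) assms(2) unfolding support_def by blast
  then have "card (f ` W) \<le> card (support r A W)" by (rule card_mono[OF finite_support])
  finally show ?thesis .
qed

text \<open>The neighbours of \<open>e\<close> are the indices \<open>i\<close> with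
  \<open>e \<in> A i\<close>, so the neighbourhood of \<open>W\<close> is exactly its
  support.\<close>

lemma partial_transversal_iff_hall:
  assumes "finite X"
  shows "partial_transversal r A X \<longleftrightarrow> (\<forall>W\<subseteq>X. card W \<le> card (support r A W))"
proof
  assume hall: "\<forall>W\<subseteq>X. card W \<le> card (support r A W)"
  have "support r A W = (\<Union>e\<in>W. {i \<in> {1..r}. e \<in> A i})" for W
    by (auto simp: support_def)
  then obtain f where "inj_on f X" "\<forall>e\<in>X. f e \<in> {i \<in> {1..r}. e \<in> A i}"
    using hall_marriage[OF assms, of "\<lambda>e. {i \<in> {1..r}. e \<in> A i}"] hall by auto
  then show "partial_transversal r A X" unfolding partial_transversal_def by blast
qed (blast intro: partial_transversal_card_le)

lemma partial_transversal_subset: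
  assumes "partial_transversal r A X" "Y \<subseteq> X"
  shows "partial_transversal r A Y"
  using assms inj_on_subset unfolding partial_transversal_def by blast

section \<open>Dependence after adding the new element\<close>

lemma partial_transversal_extend_system:
  assumes "x \<notin> X"
  shows "partial_transversal r (extend_system A x I) X \<longleftrightarrow> partial_transversal r A X"
proof -
  have "e \<in> extend_system A x I i \<longleftrightarrow> e \<in> A i" if "e \<in> X" for e i
    using that assms by (auto simp: extend_system_def)
  then show ?thesis unfolding partial_transversal_def by simp
qed

lemma support_extend_system_insert:
  assumes "x \<notin> X" "I \<subseteq> {1..r}" "\<And>i. i \<in> {1..r} \<Longrightarrow> x \<notin> A i"
  shows "support r (extend_system A x I) (insert x X) = I \<union> support r A X"
  using assms by (auto simp: support_def extend_system_def)

lemma dependent_insert_iff_tight_subset: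
  assumes "finite Z" "x \<notin> Z" "partial_transversal r A Z"
    and I: "I \<subseteq> {1..r}" and xA: "\<And>i. i \<in> {1..r} \<Longrightarrow> x \<notin> A i"
  shows "\<not> partial_transversal r (extend_system A x I) (insert x Z) \<longleftrightarrow>
    (\<exists>X\<subseteq>Z. I \<subseteq> support r A X \<and> card X = card (support r A X))"
proof
  let ?A = "extend_system A x I"
  assume "\<not> partial_transversal r ?A (insert x Z)"
  then obtain W where W: "W \<subseteq> insert x Z" "card (support r ?A W) < card W"
    using partial_transversal_iff_hall[of "insert x Z"] assms(1) by (auto simp: not_le)
  \<comment> \<open>A violating set without \<open>x\<close> would lie inside the independent set
    \<open>Z\<close> and violate Hall's condition there, since the extension changes nothing for
    sets avoiding \<open>x\<close>.\<close>
  have "x \<in> W"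
  proof (rule ccontr)
    assume "x \<notin> W"
    then have "W \<subseteq> Z" using W(1) by blast
    then have "partial_transversal r ?A W"
      using partial_transversal_subset[OF assms(3)] \<open>x \<notin> W\<close> partial_transversal_extend_system
      by metis
    then show False using partial_transversal_card_le W(2) by (metis not_le order_refl)
  qed
  define X where "X = W - {x}"
  have X: "x \<notin> X" "W = insert x X" "X \<subseteq> Z" using \<open>x \<in> W\<close> W(1) by (auto simp: X_def)
  have "finite X" using X(3) assms(1) finite_subset by blast
  \<comment> \<open>\<open>x\<close> contributes exactly one to \<open>|W|\<close>, which turns the
    strict inequality for \<open>W\<close> into a weak one for \<open>X\<close>.\<close>
  then have "card (I \<union> support r A X) \<le> card X"
    using W(2) X support_extend_system_insert[OF X(1) I xA] by simp
  moreover have le: "card X \<le> card (support r A X)"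
    using partial_transversal_card_le[OF assms(3) X(3)] .
  moreover have finU: "finite (I \<union> support r A X)"
    using I finite_support finite_subset by blast
  \<comment> \<open>The chain \<open>|I \<union> s(X)| \<le> |X| \<le> |s(X)|\<close> collapses: it
    forces \<open>I\<close> into \<open>s(X)\<close>, and then tightness of
    \<open>X\<close>.\<close>
  ultimately have "support r A X = I \<union> support r A X"
    by (intro card_seteq) auto
  moreover have "card (support r A X) \<le> card (I \<union> support r A X)"
    using finU by (intro card_mono) auto
  ultimately show "\<exists>X\<subseteq>Z. I \<subseteq> support r A X \<and> card X = card (support r A X)"
    using X(3) le \<open>card (I \<union> support r A X) \<le> card X\<close> by (intro exI[of _ X]) auto
next
  let ?A = "extend_system A x I"
  assume "\<exists>X\<subseteq>Z. I \<subseteq> support r A X \<and> card X = card (support r A X)"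
  then obtain X where X: "X \<subseteq> Z" "I \<subseteq> support r A X" "card X = card (support r A X)" by blast
  have "x \<notin> X" "finite X" using X(1) assms(1,2) finite_subset by auto
  \<comment> \<open>Since \<open>I\<close> is contained in \<open>s(X)\<close>, adding
    \<open>x\<close> adds an element but no index, so a tight set becomes too large for its
    support.\<close>
  then have "card (support r ?A (insert x X)) < card (insert x X)"
    using support_extend_system_insert[OF \<open>x \<notin> X\<close> I xA] X(2,3) by (simp add: Un_absorb1)
  then show "\<not> partial_transversal r ?A (insert x Z)"
    using partial_transversal_card_le[of r ?A "insert x Z" "insert x X"] X(1) by auto
qed

lemma indeps_transversal_matroid:
  "X \<in> indeps (transversal_matroid E r A) \<longleftrightarrow> X \<subseteq> E \<and> partial_transversal r A X"
  by (simp add: transversal_matroid_def)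

section \<open>Coloops of the deletion\<close>

text \<open>A basis avoiding \<open>x\<close> is maximal, so it becomes dependent when
  \<open>x\<close> is added, and it serves as \<open>Z\<close>. Conversely, any such
  \<open>Z\<close> extends to a basis, which cannot contain \<open>x\<close>. The assumption
  \<open>x \<notin> A k\<close> keeps \<open>x\<close> in the ground set after the deletion.\<close>

lemma not_coloop_deletion_iff:
  assumes fin: "finite E" and "x \<notin> E" "x \<notin> A k"
  shows "\<not> coloop (deletion (ext_matroid E r A x I) (A k)) x \<longleftrightarrow>
    (\<exists>Z \<subseteq> E - A k. partial_transversal r A Z \<and>
       \<not> partial_transversal r (extend_system A x I) (insert x Z))"
proof -
  let ?A = "extend_system A x I" and ?N = "deletion (ext_matroid E r A x I) (A k)"
  have ground: "x \<in> ground ?N"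
    using assms by (simp add: deletion_def ext_matroid_def transversal_matroid_def)
  have indeps: "indeps ?N = {X. X \<subseteq> insert x E - A k \<and> partial_transversal r ?A X}"
    by (auto simp: deletion_def ext_matroid_def transversal_matroid_def)
  have "finite (indeps ?N)"
    using fin unfolding indeps by (auto intro: finite_subset[of _ "Pow (insert x E)"])
  show ?thesis
  proof
    assume "\<not> coloop ?N x"
    then obtain B where B: "B \<in> indeps ?N" "\<forall>Y\<in>indeps ?N. B \<subseteq> Y \<longrightarrow> Y = B" "x \<notin> B"
      using ground unfolding coloop_def bases_def by blast
    then have "insert x B \<notin> indeps ?N" by blast
    then have "\<not> partial_transversal r ?A (insert x B)"
      using B(1) assms(3) by (simp add: indeps)
    moreover have "B \<subseteq> E - A k" "partial_transversal r A B"
      using B(1,3) partial_transversal_extend_system[OF B(3)] by (auto simp: indeps)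
    ultimately show "\<exists>Z \<subseteq> E - A k. partial_transversal r A Z \<and>
        \<not> partial_transversal r ?A (insert x Z)" by blast
  next
    assume "\<exists>Z \<subseteq> E - A k. partial_transversal r A Z \<and>
        \<not> partial_transversal r ?A (insert x Z)"
    then obtain Z where Z: "Z \<subseteq> E - A k" "partial_transversal r A Z"
      "\<not> partial_transversal r ?A (insert x Z)" by blast
    have "x \<notin> Z" using Z(1) assms(2) by blast
    then have "Z \<in> indeps ?N"
      using Z(1,2) partial_transversal_extend_system[OF \<open>x \<notin> Z\<close>] by (auto simp: indeps)
    then obtain B where B: "B \<in> indeps ?N" "Z \<subseteq> B" "\<forall>Y\<in>indeps ?N. B \<subseteq> Y \<longrightarrow> B = Y"
      using finite_has_maximal2[OF \<open>finite (indeps ?N)\<close>] by metis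
    \<comment> \<open>Otherwise \<open>insert x Z\<close> would be a subset of the independent set
      \<open>B\<close>.\<close>
    have "x \<notin> B"
      using B(1,2) Z(3) partial_transversal_subset[of r ?A B "insert x Z"] unfolding indeps by blast
    then show "\<not> coloop ?N x" using B unfolding coloop_def bases_def by blast
  qed
qed

section \<open>Closed index sets as intersections of tight supports\<close>

text \<open>Phrased through partial transversals of \<open>A\<close> instead of a matroid, as a
  common form to which both families of the theorem, (1) and (1'), are reduced.\<close>

definition tight_supports :: "'a set \<Rightarrow> nat \<Rightarrow> (nat \<Rightarrow> 'a set) \<Rightarrow> nat set set" where
  "tight_supports E r A = {support r A X | X. X \<subseteq> E \<and> partial_transversal r A X \<and>
     card X = card (support r A X)}"

text \<open>Each \<open>k\<close> outside \<open>I\<close> gets its own witness \<open>J\<close>.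
  Both the description by intersections and the circuit formula draw their tight sets from this
  form.\<close>

lemma in_closed_index_sets_iff:
  assumes fin: "finite E" and x: "x \<notin> E" and A: "\<forall>i\<in>{1..r}. A i \<subseteq> E"
  shows "I \<in> closed_index_sets E r A x \<longleftrightarrow>
    I \<subseteq> {1..r} \<and> (\<forall>k\<in>{1..r} - I. \<exists>J\<in>tight_supports E r A. I \<subseteq> J \<and> k \<notin> J)"
proof -
  have xA: "x \<notin> A i" if "i \<in> {1..r}" for i using A that x by blast
  have "\<not> coloop (deletion (ext_matroid E r A x I) (A k)) x \<longleftrightarrow>
      (\<exists>J\<in>tight_supports E r A. I \<subseteq> J \<and> k \<notin> J)"
    if I: "I \<subseteq> {1..r}" and k: "k \<in> {1..r}" for k
  proof -
    have dep: "\<not> partial_transversal r (extend_system A x I) (insert x Z) \<longleftrightarrow>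
        (\<exists>X\<subseteq>Z. I \<subseteq> support r A X \<and> card X = card (support r A X))"
      if "Z \<subseteq> E" "partial_transversal r A Z" for Z
      using that x fin finite_subset I xA by (intro dependent_insert_iff_tight_subset) auto
    have disj: "k \<notin> support r A X \<longleftrightarrow> X \<inter> A k = {}" for X using k by (simp add: support_def)
    have "(\<exists>Z \<subseteq> E - A k. partial_transversal r A Z \<and>
         \<not> partial_transversal r (extend_system A x I) (insert x Z)) \<longleftrightarrow>
       (\<exists>Z \<subseteq> E - A k. partial_transversal r A Z \<and>
         (\<exists>X\<subseteq>Z. I \<subseteq> support r A X \<and> card X = card (support r A X)))"
      using dep by (meson Diff_subset subset_trans)
    \<comment> \<open>\<open>Z\<close> can be eliminated: the tight subset \<open>X\<close> is
      itself independent and disjoint from \<open>A k\<close>, so it can play the role of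
      \<open>Z\<close>.\<close>
    also have "\<dots> \<longleftrightarrow> (\<exists>X \<subseteq> E. partial_transversal r A X \<and>
         card X = card (support r A X) \<and> I \<subseteq> support r A X \<and> X \<inter> A k = {})"
    proof
      assume "\<exists>Z \<subseteq> E - A k. partial_transversal r A Z \<and>
         (\<exists>X\<subseteq>Z. I \<subseteq> support r A X \<and> card X = card (support r A X))"
      then obtain Z X where ZX: "Z \<subseteq> E - A k" "partial_transversal r A Z" "X \<subseteq> Z"
        "I \<subseteq> support r A X" "card X = card (support r A X)" by blast
      moreover have "X \<subseteq> E" "X \<inter> A k = {}" using ZX(1,3) by blast+
      ultimately show "\<exists>X \<subseteq> E. partial_transversal r A X \<and>
         card X = card (support r A X) \<and> I \<subseteq> support r A X \<and> X \<inter> A k = {}"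
        using partial_transversal_subset[OF ZX(2,3)] by blast
    next
      assume "\<exists>X \<subseteq> E. partial_transversal r A X \<and>
         card X = card (support r A X) \<and> I \<subseteq> support r A X \<and> X \<inter> A k = {}"
      then obtain X where X: "X \<subseteq> E" "partial_transversal r A X"
        "card X = card (support r A X)" "I \<subseteq> support r A X" "X \<inter> A k = {}" by blast
      moreover have "X \<subseteq> E - A k" using X(1,5) by blast
      ultimately show "\<exists>Z \<subseteq> E - A k. partial_transversal r A Z \<and>
         (\<exists>X\<subseteq>Z. I \<subseteq> support r A X \<and> card X = card (support r A X))" by blast
    qed
    also have "\<dots> \<longleftrightarrow> (\<exists>J\<in>tight_supports E r A. I \<subseteq> J \<and> k \<notin> J)"
      using disj unfolding tight_supports_def by blast
    finally show ?thesis
      using not_coloop_deletion_iff[of E x A k r I] fin x xA[OF k] by simp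
  qed
  then show ?thesis unfolding closed_index_sets_def sigma_cl_def by blast
qed

lemma closed_index_sets_eq_all_Inters:
  assumes "finite E" "x \<notin> E" "\<forall>i\<in>{1..r}. A i \<subseteq> E"
  shows "closed_index_sets E r A x = all_Inters r (tight_supports E r A)"
proof (intro set_eqI iffI)
  fix I assume "I \<in> closed_index_sets E r A x"
  then have I: "I \<subseteq> {1..r}"
      "\<And>k. k \<in> {1..r} - I \<Longrightarrow> \<exists>J\<in>tight_supports E r A. I \<subseteq> J \<and> k \<notin> J"
    using in_closed_index_sets_iff[OF assms] by blast+
  \<comment> \<open>Every \<open>k\<close> outside \<open>I\<close> is missed by some member of this
    family. If the family is empty, no such \<open>k\<close> exists and \<open>I\<close> is
    \<open>{1..r}\<close>, in agreement with the convention for empty intersections.\<close>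
  have "I = index_Inter r {J \<in> tight_supports E r A. I \<subseteq> J}"
    using I unfolding index_Inter_def by blast
  then show "I \<in> all_Inters r (tight_supports E r A)" unfolding all_Inters_def by blast
next
  fix I assume "I \<in> all_Inters r (tight_supports E r A)"
  then obtain G where "G \<subseteq> tight_supports E r A" "I = {1..r} \<inter> \<Inter>G"
    unfolding all_Inters_def index_Inter_def by blast
  \<comment> \<open>An index \<open>k\<close> outside \<open>I\<close> is missed by some member of
    \<open>G\<close>, and every member of \<open>G\<close> contains \<open>I\<close>.\<close>
  then show "I \<in> closed_index_sets E r A x"
    unfolding in_closed_index_sets_iff[OF assms] by blast
qed

text \<open>Singleton subfamilies suffice. This absorbs the sets of kind (1) into those of kind
  (2).\<close>

lemma subset_all_Inters:
  assumes "\<And>J. J \<in> F \<Longrightarrow> J \<subseteq> {1..r}"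
  shows "F \<subseteq> all_Inters r F"
proof
  fix J assume J: "J \<in> F"
  then have "J = index_Inter r {J}" using assms unfolding index_Inter_def by blast
  then show "J \<in> all_Inters r F" using J unfolding all_Inters_def by blast
qed

section \<open>Recovering a closed set from the circuits through the new element\<close>

text \<open>For a circuit \<open>C\<close> through \<open>x\<close>, the independent set
  \<open>C - {x}\<close> becomes dependent when \<open>x\<close> is added, so it contains a tight
  set whose support contains \<open>I\<close>. For \<open>k\<close> outside \<open>I\<close>,
  closedness gives a tight \<open>X\<close> whose support contains \<open>I\<close> but not
  \<open>k\<close>; a circuit inside \<open>insert x X\<close> then excludes
  \<open>k\<close>.\<close>

lemma closed_index_set_eq_circuit_supports:
  assumes fin: "finite E" and x: "x \<notin> E" and A: "\<forall>i\<in>{1..r}. A i \<subseteq> E"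
    and closed: "I \<in> closed_index_sets E r A x"
  shows "I = index_Inter r
    {support r A (C - {x}) | C. C \<in> circuits (ext_matroid E r A x I) \<and> x \<in> C}"
    (is "I = index_Inter r ?F")
proof
  let ?A = "extend_system A x I" and ?N = "ext_matroid E r A x I"
  have I: "I \<subseteq> {1..r}" using closed in_closed_index_sets_iff[OF fin x A] by blast
  have xA: "x \<notin> A i" if "i \<in> {1..r}" for i using A that x by blast
  have indeps: "X \<in> indeps ?N \<longleftrightarrow> X \<subseteq> insert x E \<and> partial_transversal r ?A X" for X
    by (simp add: ext_matroid_def indeps_transversal_matroid)
  have ground: "ground ?N = insert x E" by (simp add: ext_matroid_def transversal_matroid_def)
  have dep: "\<not> partial_transversal r ?A (insert x Z) \<longleftrightarrow>
      (\<exists>X\<subseteq>Z. I \<subseteq> support r A X \<and> card X = card (support r A X))"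
    if "Z \<subseteq> E" "partial_transversal r A Z" for Z
    using that x fin finite_subset I xA by (intro dependent_insert_iff_tight_subset) auto
  have "I \<subseteq> support r A (C - {x})" if C: "C \<in> circuits ?N" "x \<in> C" for C
  proof -
    have "C - {x} \<in> indeps ?N" "C \<notin> indeps ?N" "C \<subseteq> insert x E"
      using C ground unfolding circuits_def by auto
    then have "partial_transversal r A (C - {x})" "\<not> partial_transversal r ?A (insert x (C - {x}))"
      "C - {x} \<subseteq> E"
      using partial_transversal_extend_system[of x "C - {x}"] C(2)
      by (auto simp: indeps insert_absorb)
    then obtain X where "X \<subseteq> C - {x}" "I \<subseteq> support r A X"
      using dep[of "C - {x}"] by blast
    then show ?thesis using support_mono by blast
  qed
  then show "I \<subseteq> index_Inter r ?F" using I unfolding index_Inter_def by blast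
  show "index_Inter r ?F \<subseteq> I"
  proof (rule ccontr)
    assume "\<not> index_Inter r ?F \<subseteq> I"
    then obtain k where k: "k \<in> {1..r} - I" "\<And>J. J \<in> ?F \<Longrightarrow> k \<in> J"
      unfolding index_Inter_def by blast
    then obtain X where X: "X \<subseteq> E" "partial_transversal r A X"
        "card X = card (support r A X)" "I \<subseteq> support r A X" "k \<notin> support r A X"
      using closed unfolding in_closed_index_sets_iff[OF fin x A] tight_supports_def by blast
    \<comment> \<open>A minimal member of this finite family of dependent sets is the required
      circuit.\<close>
    let ?D = "{D. D \<subseteq> insert x X \<and> D \<notin> indeps ?N}"
    have "finite X" using X(1) fin finite_subset by blast
    then have "finite ?D" by simp
    moreover have "insert x X \<in> ?D" using dep[OF X(1,2)] X(3,4) by (auto simp: indeps)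
    ultimately obtain C where C: "C \<in> ?D" "\<forall>D\<in>?D. D \<subseteq> C \<longrightarrow> C = D"
      using finite_has_minimal[of ?D] by auto
    have "D \<in> indeps ?N" if "D \<subset> C" for D
    proof (rule ccontr)
      assume "D \<notin> indeps ?N"
      then have "D \<in> ?D" using that C(1) by auto
      then show False using C(2) that by auto
    qed
    then have "C \<in> circuits ?N" using C(1) X(1) ground unfolding circuits_def by auto
    \<comment> \<open>A circuit without \<open>x\<close> would be a dependent subset of the
      independent set \<open>X\<close>.\<close>
    moreover have "x \<in> C"
    proof (rule ccontr)
      assume "x \<notin> C"
      then have "C \<subseteq> X" using C(1) by blast
      then show False
        using C(1) X(1) partial_transversal_subset[OF X(2)] partial_transversal_extend_system[OF \<open>x \<notin> C\<close>]
        by (auto simp: indeps)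
    qed
    ultimately have "k \<in> support r A (C - {x})" using k(2) by blast
    moreover have "C - {x} \<subseteq> X" using C(1) by blast
    ultimately show False using X(5) support_mono by blast
  qed
qed

section \<open>Rank and the variant (1')\<close>

lemma matroid_rank_of_witness:
  assumes "matroid M"
  obtains X where "X \<in> indeps M" "X \<subseteq> Y" "card X = rank_of M Y"
proof -
  have "finite (indeps M)" "{} \<in> indeps M"
    using assms unfolding matroid_def by (auto intro: finite_subset)
  then have "rank_of M Y \<in> card ` {X \<in> indeps M. X \<subseteq> Y}"
    unfolding rank_of_def by (intro Max_in) auto
  then show thesis using that by auto
qed

lemma rank_of_indep:
  assumes "matroid M" "X \<in> indeps M"
  shows "rank_of M X = card X"
proof (rule antisym)
  have fin: "finite (indeps M)" "finite X"
    using assms unfolding matroid_def by (auto intro: finite_subset)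
  obtain Z where "Z \<in> indeps M" "Z \<subseteq> X" "card Z = rank_of M X"
    using matroid_rank_of_witness[OF assms(1)] .
  then show "rank_of M X \<le> card X" using card_mono[OF fin(2)] by metis
  show "card X \<le> rank_of M X"
    unfolding rank_of_def using fin assms(2) by (intro Max_ge) auto
qed

text \<open>A maximum independent subset \<open>X\<close> of \<open>Y\<close> satisfies
  \<open>|X| \<le> |s(X)| \<le> |s(Y)| = |X|\<close>, hence is tight with
  \<open>s(X) = s(Y)\<close>. In the other direction a tight set serves as its own \<open>Y\<close>,
  its rank being its size.\<close>

lemma supports_of_full_rank_eq_tight_supports:
  assumes "matroid M" and M: "M = transversal_matroid E r A"
  shows "{support r A Y | Y. Y \<subseteq> E \<and> rank_of M Y = card (support r A Y)} = tight_supports E r A"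
proof (intro set_eqI iffI)
  fix J assume "J \<in> {support r A Y | Y. Y \<subseteq> E \<and> rank_of M Y = card (support r A Y)}"
  then obtain Y where Y: "J = support r A Y" "Y \<subseteq> E" "rank_of M Y = card (support r A Y)" by blast
  obtain X where X: "X \<in> indeps M" "X \<subseteq> Y" "card X = rank_of M Y"
    using matroid_rank_of_witness[OF assms(1)] .
  have X': "X \<subseteq> E" "partial_transversal r A X"
    using X(1) M by (simp_all add: indeps_transversal_matroid)
  have "card X \<le> card (support r A X)"
    using partial_transversal_card_le[OF X'(2)] by blast
  then have "support r A X = support r A Y"
    using X(3) Y(3) by (intro card_seteq finite_support support_mono X(2)) simp
  then show "J \<in> tight_supports E r A"
    using X(3) X' Y(1,3) unfolding tight_supports_def by auto
next
  fix J assume "J \<in> tight_supports E r A"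
  then obtain X where X: "J = support r A X" "X \<subseteq> E" "partial_transversal r A X"
    "card X = card (support r A X)" unfolding tight_supports_def by blast
  then have "rank_of M X = card X"
    using rank_of_indep[OF assms(1)] M by (simp add: indeps_transversal_matroid)
  then show "J \<in> {support r A Y | Y. Y \<subseteq> E \<and> rank_of M Y = card (support r A Y)}"
    using X by auto
qed

theorem theorem3p7:
  fixes M :: "'a indep_system" and E :: "'a set" and r :: nat
    and A :: "nat \<Rightarrow> 'a set" and x :: 'a
  assumes "matroid M" and "ground M = E" and "presentation r A M" and "x \<notin> E"
  defines "S \<equiv> {support r A X | X. X \<in> indeps M \<and> card X = card (support r A X)}"
    and "S' \<equiv> {support r A Y | Y. Y \<subseteq> E \<and> rank_of M Y = card (support r A Y)}"
  shows "closed_index_sets E r A x = S \<union> all_Inters r S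
    \<and> (\<forall>I \<in> closed_index_sets E r A x.
          I = index_Inter r {support r A (C - {x}) | C. C \<in> circuits (ext_matroid E r A x I) \<and> x \<in> C})
    \<and> closed_index_sets E r A x = S' \<union> all_Inters r S'"
proof -
  have fin: "finite E" using assms(1,2) unfolding matroid_def by blast
  have A: "\<forall>i\<in>{1..r}. A i \<subseteq> E"
    using assms(2,3) unfolding presentation_def by blast
  have M: "M = transversal_matroid E r A"
    using assms(2,3) unfolding presentation_def by blast
  have S: "S = tight_supports E r A"
    unfolding S_def tight_supports_def M by (simp add: indeps_transversal_matroid conj_assoc)
  have S': "S' = tight_supports E r A"
    unfolding S'_def by (rule supports_of_full_rank_eq_tight_supports[OF assms(1) M])
  \<comment> \<open>With \<open>S\<close> and \<open>S'\<close> both identified with the tight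
    supports, the unions in the statement reduce to the intersections alone.\<close>
  have "tight_supports E r A \<subseteq> all_Inters r (tight_supports E r A)"
    by (rule subset_all_Inters) (auto simp: tight_supports_def support_def)
  then have "closed_index_sets E r A x = tight_supports E r A \<union> all_Inters r (tight_supports E r A)"
    using closed_index_sets_eq_all_Inters[OF fin assms(4) A] by blast
  then show ?thesis
    using closed_index_set_eq_circuit_supports[OF fin assms(4) A] unfolding S S' by blast
qed

end
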